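(* Let $(K,\mathrm{val})$ be an algebraically closed valued field of characteristic $0$ with $\mathrm{val}(2)=0$. Then the tropicalization of any cubic in Brundu-Logar normal form over $K$ is not tropically smooth. That is, for every $P=(a,b,c,d,g)\in\mathbb{P}^4_K\setminus\Sigma$, the tropical surface $V(\mathrm{trop}(f_P))$ defined by the Brundu-Logar cubic $f_P$ is not smooth.
   Context: Brundu-Logar normal form. For $P=(a,b,c,d,g)$ let $$\begin{aligned} f_P=\;&2a\,x_1^2x_2+(b-g)x_1^2x_3+(-2a)x_1x_2^2+(d+g)x_1x_2x_3+(a-c-d)x_1x_3^2\\&+(b+g)x_1x_2x_4+(-a-b-c)x_1x_3x_4+(d-g)x_2^2x_4+(a+c-d)x_2x_3x_4\\&+(-a-b+c)x_2x_4^2\in K[x_1,x_2,x_3,x_4].\end{aligned}$$ A homogeneous cubic is in Brundu-Logar normal form if it equals $f_P$ for some $P=(a,b,c,d,g)\in\mathbb{P}^4\setminus\Sigma$, where $\Sigma=V(\sigma)\subset\mathbb{P}^4$ is the hypersurface defined by $$\begin{aligned}\sigma=\;&c(a+b-c)(2a+b-d)(a-c-d)(a+c+g)(a+c-g)(4ac-g^2)\\&\cdot(a^2+ac-2ad+ag+d^2-dg)\,(a^2+2ab+ac-ag+b^2-bg)\\&\cdot(4a^2+3ab-4ac-3ad-bc-2bd+bg+cd+dg)\\&\cdot(4a^3+4a^2b+8a^2c-4a^2d+ab^2-4abc-2abd+2abg+4ac^2+4acd+ad^2\\&\quad+2adg+b^2c+b^2g+2bcd-2bcg+cd^2-2cdg-d^2g).\end{aligned}$$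 Tropicalization and smoothness. The min-convention is used: for $f=\sum_u c_ux^u$, $\mathrm{trop}(f)(w)=\min_u(\mathrm{val}(c_u)+u\cdot w)$ (with $\mathrm{val}(0)=\infty$, i.e. monomials with zero coefficient are omitted), and $V(\mathrm{trop}(f))$ is the locus where the minimum is attained at least twice. The Newton polytope $\mathrm{Newt}(f)$ is the convex hull of the exponents $u$ with $c_u\ne0$; the weights $\mathrm{val}(c_u)$ induce a regular subdivision of $\mathrm{Newt}(f)$ dual to $V(\mathrm{trop}(f))$. The tropical surface $V(\mathrm{trop}(f))$ is smooth (and $f$ is tropically smooth) if and only if this dual subdivision is unimodular, i.e. all its maximal cells are lattice tetrahedra of volume $\frac16$ (after dehomogenizing, e.g. dropping the last exponent). *)

theory Defs
  imports
    "HOL-Analysis.Analysis"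
    "HOL-Library.Poly_Mapping"
    "HOL-Computational_Algebra.Polynomial"
begin

section \<open>Valued fields\<close>

text \<open>Valuations of rank at most one, with values in the reals together with infinity;
  the trivial valuation is not excluded.\<close>

definition is_valuation :: "('k::field \<Rightarrow> ereal) \<Rightarrow> bool" where
  "is_valuation val \<longleftrightarrow>
     (\<forall>x. val x \<noteq> -\<infinity>) \<and>
     (\<forall>x. val x = \<infinity> \<longleftrightarrow> x = 0) \<and>
     (\<forall>x y. val (x * y) = val x + val y) \<and>
     (\<forall>x y. val (x + y) \<ge> min (val x) (val y))"

section \<open>Polynomials in four variables\<close>

text \<open>An exponent is a map from the index type \<^typ>\<open>4\<close>, a polynomial a finitely supported map
  from exponents to coefficients, with the convolution product of \<^theory>\<open>HOL-Library.Poly_Mapping\<close>.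
  As usual for \<^typ>\<open>real^4\<close>, the indices are written 1, 2, 3, 4 (where 4 is the
  element 0 of the index type).\<close>

type_synonym exponent = "4 \<Rightarrow>\<^sub>0 nat"
type_synonym 'k poly4 = "exponent \<Rightarrow>\<^sub>0 'k"

definition Var :: "4 \<Rightarrow> 'k::comm_ring_1 poly4" where
  "Var i = Poly_Mapping.single (Poly_Mapping.single i 1) 1"

definition Const :: "'k::comm_ring_1 \<Rightarrow> 'k poly4" where
  "Const c = Poly_Mapping.single 0 c"

definition expvec :: "exponent \<Rightarrow> real^4" where
  "expvec u = (\<chi> i. real (Poly_Mapping.lookup u i))"

section \<open>Tropicalization and smoothness\<close>

definition trop :: "('k::zero \<Rightarrow> ereal) \<Rightarrow> 'k poly4 \<Rightarrow> real^4 \<Rightarrow> ereal" where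
  "trop val f w = (INF u\<in>Poly_Mapping.keys f. val (Poly_Mapping.lookup f u) + ereal (expvec u \<bullet> w))"

text \<open>The infimum ranges over a finite set: it is a minimum, and \<open>\<infinity>\<close> for the zero polynomial.
  The tropical surface of \<open>f\<close> is the locus where it is attained at least twice; its dual
  subdivision is the regular subdivision of the Newton polytope of \<open>f\<close> induced by the weights
  \<open>val c\<^sub>u\<close>.  The cells are the projections of the lower faces of the convex hull of the lifted
  exponents \<open>(u, val c\<^sub>u)\<close>; below, the lower face is the one with inner normal \<open>(w, 1)\<close>, on which
  the minimum defining \<open>trop val f w\<close> is attained.\<close>

definition dual_cell :: "('k::zero \<Rightarrow> ereal) \<Rightarrow> 'k poly4 \<Rightarrow> real^4 \<Rightarrow> (real^4) set" where
  "dual_cell val f w =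
     convex hull (expvec ` {u \<in> Poly_Mapping.keys f.
       val (Poly_Mapping.lookup f u) + ereal (expvec u \<bullet> w) = trop val f w})"

definition dual_subdivision :: "('k::zero \<Rightarrow> ereal) \<Rightarrow> 'k poly4 \<Rightarrow> (real^4) set set" where
  "dual_subdivision val f = range (dual_cell val f)"

definition maximal_cells :: "('k::zero \<Rightarrow> ereal) \<Rightarrow> 'k poly4 \<Rightarrow> (real^4) set set" where
  "maximal_cells val f =
     {C \<in> dual_subdivision val f. \<forall>D \<in> dual_subdivision val f. C \<subseteq> D \<longrightarrow> C = D}"

definition lattice_tetrahedron :: "(real^4) set \<Rightarrow> bool" where
  "lattice_tetrahedron C \<longleftrightarrow>
     3 simplex C \<and> (\<forall>v. v extreme_point_of C \<longrightarrow> (\<forall>i. v $ i \<in> \<int>))"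

definition dehomogenize :: "real^4 \<Rightarrow> real^3" where
  "dehomogenize v = vector [v $ 1, v $ 2, v $ 3]"

text \<open>For homogeneous \<open>f\<close>: smoothness of the tropical surface of \<open>f\<close>, as unimodularity of the dual
  subdivision.  If the Newton polytope has dimension less than 3, then no
  cell has positive volume, and \<open>f\<close> is not tropically smooth.\<close>

definition tropically_smooth :: "('k::zero \<Rightarrow> ereal) \<Rightarrow> 'k poly4 \<Rightarrow> bool" where
  "tropically_smooth val f \<longleftrightarrow>
     (\<forall>C \<in> maximal_cells val f.
        lattice_tetrahedron C \<and> measure lborel (dehomogenize ` C) = 1 / 6)"

section \<open>Brundu-Logar normal form\<close>

definition BL_cubic :: "'k::comm_ring_1 \<Rightarrow> 'k \<Rightarrow> 'k \<Rightarrow> 'k \<Rightarrow> 'k \<Rightarrow> 'k poly4" where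
  "BL_cubic a b c d g =
     Const (2 * a) * Var 1 ^ 2 * Var 2
   + Const (b - g) * Var 1 ^ 2 * Var 3
   + Const (- 2 * a) * Var 1 * Var 2 ^ 2
   + Const (d + g) * Var 1 * Var 2 * Var 3
   + Const (a - c - d) * Var 1 * Var 3 ^ 2
   + Const (b + g) * Var 1 * Var 2 * Var 4
   + Const (- a - b - c) * Var 1 * Var 3 * Var 4
   + Const (d - g) * Var 2 ^ 2 * Var 4
   + Const (a + c - d) * Var 2 * Var 3 * Var 4
   + Const (- a - b + c) * Var 2 * Var 4 ^ 2"

definition BL_sigma :: "'k::comm_ring_1 \<Rightarrow> 'k \<Rightarrow> 'k \<Rightarrow> 'k \<Rightarrow> 'k \<Rightarrow> 'k" where
  "BL_sigma a b c d g =
     c * (a + b - c) * (2 * a + b - d) * (a - c - d) * (a + c + g) * (a + c - g) * (4 * a * c - g ^ 2)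
   * (a ^ 2 + a * c - 2 * a * d + a * g + d ^ 2 - d * g)
   * (a ^ 2 + 2 * a * b + a * c - a * g + b ^ 2 - b * g)
   * (4 * a ^ 2 + 3 * a * b - 4 * a * c - 3 * a * d - b * c - 2 * b * d + b * g + c * d + d * g)
   * (4 * a ^ 3 + 4 * a ^ 2 * b + 8 * a ^ 2 * c - 4 * a ^ 2 * d + a * b ^ 2 - 4 * a * b * c
      - 2 * a * b * d + 2 * a * b * g + 4 * a * c ^ 2 + 4 * a * c * d + a * d ^ 2
      + 2 * a * d * g + b ^ 2 * c + b ^ 2 * g + 2 * b * c * d - 2 * b * c * g + c * d ^ 2
      - 2 * c * d * g - d ^ 2 * g)"

text \<open>A point of the projective 4-space is given by homogeneous coordinates, not all zero; scaling
  these scales the cubic (so adds a constant to its tropicalization) and does not affect whether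
  \<open>BL_sigma\<close> vanishes.\<close>

definition BL_normal_form :: "'k::comm_ring_1 poly4 \<Rightarrow> bool" where
  "BL_normal_form f \<longleftrightarrow>
     (\<exists>a b c d g. (a, b, c, d, g) \<noteq> (0, 0, 0, 0, 0) \<and> BL_sigma a b c d g \<noteq> 0
        \<and> f = BL_cubic a b c d g)"

end

(* Look at the cell dual to w = 0, spanned by the exponents whose coefficient has minimal valuation.
   The ten coefficients satisfy linear relations with coefficients 1 and -1, and the elements of
   larger than minimal valuation form a subgroup; these force the cell to contain four distinct
   exponents with even sum.  The only lattice points of a unimodular tetrahedron are its
   vertices, so the four exponents would be all the vertices of a unimodular maximal cell; but the
   half sum of these vertices is then not a lattice point. *)

theory Submission
  imports Defs
begin

section \<open>Lattice points of unimodular simplices\<close>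

lemma det_Ints:
  fixes A :: "'a::comm_ring_1^'n^'n"
  assumes "\<And>i j. A $ i $ j \<in> \<int>"
  shows "det A \<in> \<int>"
  unfolding det_def using assms by (intro Ints_sum Ints_mult Ints_prod) auto

text \<open>Cramer's rule: \<open>t $ k * det M\<close> is the determinant of \<open>M\<close> with
  column \<open>k\<close> replaced by \<open>M *v t\<close>. This matrix is integral, and dividing
  by \<open>det M\<close> changes at most the sign.\<close>

lemma Ints_vec_if_unimodular:
  fixes M :: "real^'n^'n" and t :: "real^'n"
  assumes "\<And>i j. M $ i $ j \<in> \<int>" and "\<bar>det M\<bar> = 1" and "\<And>i. (M *v t) $ i \<in> \<int>"
  shows "t $ k \<in> \<int>"
proof -
  have "t $ k * det M \<in> \<int>"
    unfolding cramer_lemma[symmetric] using assms by (intro det_Ints) auto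
  with assms(2) show ?thesis
    by (auto simp: abs_if split: if_splits)
qed

text \<open>In coordinates adapted to the edges at a vertex, a lattice point of a unimodular simplex has
  integral barycentric coordinates, and the barycentric coordinates of the half sum of the vertices
  are all \<open>1/2\<close>.\<close>

lemma unimodular_simplex:
  fixes X :: "(real^'n::{finite,wellorder}) set"
  assumes X: "finite X" "card X = Suc CARD('n)" "\<And>v i. v \<in> X \<Longrightarrow> v $ i \<in> \<int>"
    and vol: "measure lborel (convex hull X) = 1 / fact CARD('n)"
  shows Ints_point_in_unimodular_simplex:
      "p \<in> convex hull X \<Longrightarrow> (\<And>i. p $ i \<in> \<int>) \<Longrightarrow> p \<in> X"
    and half_sum_unimodular_simplex:
      "odd CARD('n) \<Longrightarrow> \<exists>i. (\<Sum>v\<in>X. v $ i) / 2 \<notin> \<int>"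
proof -
  obtain x0 where x0: "x0 \<in> X"
    using X(2) by fastforce
  have "card (X - {x0}) = CARD('n)"
    using X x0 by simp
  then obtain f :: "'n \<Rightarrow> _" where f: "bij_betw f UNIV (X - {x0})"
    using finite_same_card_bij[of "UNIV::'n set" "X - {x0}"] X(1) by auto
  \<comment> \<open>The columns are the edge vectors from \<open>x0\<close> to the other vertices,
    so the volume of the simplex is the absolute value of \<open>det M\<close> divided by the
    factorial of the dimension.\<close>
  define M where "M = (\<chi> i. \<chi> j. f j $ i - x0 $ i)"
  have detM: "\<bar>det M\<bar> = 1"
    using content_simplex[OF X(1,2) x0 f] vol unfolding M_def[symmetric] by simp
  have fX: "f j \<in> X" for j
    using f by (auto simp: bij_betw_def)
  have M_Ints: "M $ i $ j \<in> \<int>" for i j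
    using X(3) x0 fX by (auto simp: M_def)
  have sum_X: "(\<Sum>x\<in>X. h x) = h x0 + (\<Sum>j\<in>UNIV. h (f j))" for h :: "_ \<Rightarrow> real"
    using X(1) x0 sum.reindex_bij_betw[OF f, of h] by (simp add: sum.remove)
  \<comment> \<open>Both sides are coordinates of the sum of \<open>u x * (x - x0)\<close> over
    \<open>X\<close>; the term at \<open>x0\<close> vanishes.\<close>
  have M_mult: "(M *v (\<chi> j. u (f j))) $ i = (\<Sum>x\<in>X. u x * x $ i) - (\<Sum>x\<in>X. u x) * x0 $ i"
    for u :: "_ \<Rightarrow> real" and i
    by (simp add: sum_X matrix_vector_mult_def M_def sum_distrib_left sum_distrib_right
        algebra_simps sum_subtractf)
  show "p \<in> X" if p: "p \<in> convex hull X" and pI: "\<And>i. p $ i \<in> \<int>"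
  proof -
    obtain u where u: "\<And>x. x \<in> X \<Longrightarrow> 0 \<le> u x" "sum u X = 1" "(\<Sum>x\<in>X. u x *\<^sub>R x) = p"
      using p convex_hull_finite[OF X(1)] by auto
    have pi: "p $ i = (\<Sum>x\<in>X. u x * x $ i)" for i
      by (simp add: u(3)[symmetric])
    \<comment> \<open>The weights sum to 1, so by \<open>M_mult\<close> the image under
      \<open>M\<close> is \<open>p - x0\<close>, which is integral.\<close>
    have "(\<chi> j. u (f j)) $ k \<in> \<int>" for k
      by (rule Ints_vec_if_unimodular[OF M_Ints detM])
        (use M_mult[of u] pi pI u(2) X(3)[OF x0] in auto)
    then have uf: "u (f k) \<in> \<int>" for k
      by simp
    have "u x0 = 1 - (\<Sum>j\<in>UNIV. u (f j))"
      using u(2) sum_X[of u] by simp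
    then have "u x0 \<in> \<int>"
      using uf by (auto intro: Ints_sum)
    then have uI: "u x \<in> \<int>" if "x \<in> X" for x
      using uf that f by (cases "x = x0") (simp, metis Diff_iff bij_betw_imp_surj_on rangeE singletonD)
    obtain y where y: "y \<in> X" "u y \<noteq> 0"
      using u(2) by (metis sum.neutral zero_neq_one)
    \<comment> \<open>Nonnegative integral weights with sum 1 are concentrated at a single vertex,
      so \<open>p\<close> is that vertex.\<close>
    have "u y \<ge> 1"
      using uI[OF y(1)] u(1)[OF y(1)] y(2) by (auto elim!: Ints_cases)
    moreover have split: "sum u X = u y + sum u (X - {y})"
      using X(1) y(1) by (rule sum.remove)
    moreover have "sum u (X - {y}) \<ge> 0"
      using u(1) by (intro sum_nonneg) auto
    ultimately have uy: "u y = 1" "sum u (X - {y}) = 0"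
      using u(2) by linarith+
    then have "\<forall>x\<in>X - {y}. u x = 0"
      using X(1) u(1) by (subst (asm) sum_nonneg_eq_0_iff) auto
    then have "(\<Sum>x\<in>X. u x *\<^sub>R x) = y"
      using uy X(1) y(1) by (simp add: sum.remove)
    then show ?thesis
      using u(3) y by simp
  qed
  show "\<exists>i. (\<Sum>v\<in>X. v $ i) / 2 \<notin> \<int>" if odd: "odd CARD('n)"
  proof (rule ccontr)
    assume "\<not> ?thesis"
    then have half: "(\<Sum>v\<in>X. v $ i) / 2 \<in> \<int>" for i
      by simp
    \<comment> \<open>An odd dimension gives an even number of vertices. Hence the half sum differs
      from \<open>M\<close> applied to the constant vector 1/2 by an integral multiple of
      \<open>x0\<close>.\<close>
    have card_half: "real (card X) / 2 \<in> \<int>"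
      using odd X(2) by (auto elim!: oddE simp: add_divide_distrib)
    have "(M *v (\<chi> j. 1/2)) $ i \<in> \<int>" for i
    proof -
      have "(M *v (\<chi> j. 1/2)) $ i = (\<Sum>x\<in>X. x $ i) / 2 - real (card X) / 2 * x0 $ i"
        using M_mult[of "\<lambda>_. 1/2"] by (simp add: sum_divide_distrib)
      then show ?thesis
        by (simp only:) (intro Ints_diff Ints_mult half card_half X(3)[OF x0])
    qed
    then have "(1/2::real) \<in> \<int>"
      using Ints_vec_if_unimodular[OF M_Ints detM, of "\<chi> j. 1/2"] by simp
    then show False
      using fraction_not_in_Ints[of 2 1] by simp
  qed
qed

lemma measure_lborel_convex_hull_few_points:
  fixes X :: "'a::euclidean_space set"
  assumes "finite X" "card X \<le> DIM('a)"
  shows "measure lborel (convex hull X) = 0"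
proof -
  have "negligible (convex hull X)"
    using empty_interior_convex_hull[OF assms] by (simp add: negligible_convex_interior)
  moreover have "convex hull X \<in> sets borel"
    using assms(1) by (simp add: finite_imp_compact_convex_hull borel_compact)
  ultimately show ?thesis
    using negligible_imp_measure0[of "convex hull X"] by simp
qed

text \<open>\<open>X\<close> will be the projection of the vertices of a cell, so at first only an
  upper bound on its size is known. Fewer than four points have a hull of volume 0 in 3-space, so
  the volume forces exactly four. The lattice points in \<open>P\<close> are then vertices, and
  being four they are all of them.\<close>

lemma odd_sum_of_lattice_points:
  fixes X P :: "(real^3) set"
  assumes "finite X" "card X \<le> 4" "\<And>v i. v \<in> X \<Longrightarrow> v $ i \<in> \<int>"
    and vol: "measure lborel (convex hull X) = 1 / 6"
    and P: "P \<subseteq> convex hull X" "\<And>p i. p \<in> P \<Longrightarrow> p $ i \<in> \<int>" "card P = 4"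
  shows "\<exists>i. (\<Sum>p\<in>P. p $ i) / 2 \<notin> \<int>"
proof -
  have card: "card X = Suc CARD(3)"
    using assms(2) measure_lborel_convex_hull_few_points[OF assms(1)] vol
    by (cases "card X = 4") auto
  have vol': "measure lborel (convex hull X) = 1 / fact CARD(3)"
    using vol by (simp add: fact_numeral)
  have "P \<subseteq> X"
    using Ints_point_in_unimodular_simplex[OF assms(1) card assms(3) vol'] P by blast
  then have "P = X"
    using assms(1) card P(3) by (intro card_subset_eq) auto
  then show ?thesis
    using half_sum_unimodular_simplex[OF assms(1) card assms(3) vol'] by simp
qed

section \<open>Smoothness as a parity condition on the exponents of minimal weight\<close>

lemma linear_dehomogenize: "linear dehomogenize"
  by (rule linearI) (simp_all add: dehomogenize_def vec_eq_iff forall_3)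

text \<open>Since \<open>j\<close> does not depend on \<open>u\<close>, a coordinate of a sum of
  projected exponents is a single coordinate of the sum of the exponents.\<close>

lemma dehomogenize_expvec_nth:
  "\<exists>j. \<forall>u. dehomogenize (expvec u) $ i = real (Poly_Mapping.lookup u j)"
  using exhaust_3[of i] by (auto simp: dehomogenize_def expvec_def)

text \<open>In a fixed degree the dropped fourth entry is determined by the other three.\<close>

lemma inj_on_dehomogenize_expvec:
  assumes "\<And>u. u \<in> Q \<Longrightarrow> (\<Sum>i\<in>UNIV. Poly_Mapping.lookup u i) = d"
  shows "inj_on (\<lambda>u. dehomogenize (expvec u)) Q"
proof (rule inj_onI)
  fix u v assume uv: "u \<in> Q" "v \<in> Q" and eq: "dehomogenize (expvec u) = dehomogenize (expvec v)"
  have "Poly_Mapping.lookup u i = Poly_Mapping.lookup v i" if "i = 1 \<or> i = 2 \<or> i = 3" for i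
    using eq that by (auto simp: dehomogenize_def expvec_def vec_eq_iff forall_3)
  moreover from this have "Poly_Mapping.lookup u 4 = Poly_Mapping.lookup v 4"
    using assms[OF uv(1)] assms[OF uv(2)] by (simp add: sum_4)
  ultimately show "u = v"
    using exhaust_4 by (intro poly_mapping_eqI) metis
qed

text \<open>The points of \<open>Q\<close> lie in the cell dual to \<open>w = 0\<close>. This cell
  may fail to be maximal, but it is contained in a maximal one, whose projection to 3-space has
  volume 1/6 and integral vertices; \<open>odd_sum_of_lattice_points\<close> applies there.\<close>

lemma odd_sum_if_tropically_smooth:
  assumes smooth: "tropically_smooth val f"
    and Q: "Q \<subseteq> Poly_Mapping.keys f" "card Q = 4"
      "\<And>u. u \<in> Q \<Longrightarrow> (\<Sum>i\<in>UNIV. Poly_Mapping.lookup u i) = d"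
    and minimal: "\<And>u v. u \<in> Q \<Longrightarrow> v \<in> Poly_Mapping.keys f \<Longrightarrow>
      val (Poly_Mapping.lookup f u) \<le> val (Poly_Mapping.lookup f v)"
  shows "\<exists>i. odd (\<Sum>u\<in>Q. Poly_Mapping.lookup u i)"
proof -
  have "trop val f 0 = val (Poly_Mapping.lookup f u)" if "u \<in> Q" for u
    unfolding trop_def using that Q minimal
    by (intro antisym INF_lower2[of u] INF_greatest) auto
  then have Q_cell: "expvec ` Q \<subseteq> dual_cell val f 0"
    unfolding dual_cell_def using Q by (intro order_trans[OF _ hull_subset] image_mono) auto
  \<comment> \<open>Every cell is the hull of a subset of a finite set of exponents. So there are
    finitely many cells, and each lies in a maximal one.\<close>
  have "dual_subdivision val f \<subseteq> (\<lambda>S. convex hull (expvec ` S)) ` Pow (Poly_Mapping.keys f)"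
    unfolding dual_subdivision_def dual_cell_def by auto
  then have "finite (dual_subdivision val f)"
    by (rule finite_subset) simp
  then obtain C where C: "C \<in> maximal_cells val f" "dual_cell val f 0 \<subseteq> C"
    using finite_has_maximal2[of "dual_subdivision val f" "dual_cell val f 0"]
    by (auto simp: maximal_cells_def dual_subdivision_def)
  then have C': "lattice_tetrahedron C" "measure lborel (dehomogenize ` C) = 1 / 6"
    using smooth by (auto simp: tropically_smooth_def)
  then obtain V where V: "\<not> affine_dependent V" "card V = 4" "C = convex hull V"
    by (auto simp: lattice_tetrahedron_def simplex_def)
  have fin: "finite V"
    using V(2) card.infinite by fastforce
  have VI: "v $ i \<in> \<int>" if "v \<in> V" for v i
    using C' that V extreme_point_of_convex_hull_affine_independent
    by (auto simp: lattice_tetrahedron_def)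
  define P where "P = (\<lambda>u. dehomogenize (expvec u)) ` Q"
  have inj: "inj_on (\<lambda>u. dehomogenize (expvec u)) Q"
    by (rule inj_on_dehomogenize_expvec[OF Q(3)])
  have "\<exists>i. (\<Sum>p\<in>P. p $ i) / 2 \<notin> \<int>"
  proof (rule odd_sum_of_lattice_points)
    show "finite (dehomogenize ` V)" "card (dehomogenize ` V) \<le> 4"
      using fin V(2) card_image_le[of V dehomogenize] by auto
    show "v $ i \<in> \<int>" if "v \<in> dehomogenize ` V" for v i
      using that VI exhaust_3[of i] by (auto simp: dehomogenize_def)
    show "measure lborel (convex hull (dehomogenize ` V)) = 1 / 6"
      using C'(2) V(3) convex_hull_linear_image[OF linear_dehomogenize] by simp
    show "P \<subseteq> convex hull (dehomogenize ` V)"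
      using Q_cell C(2) V(3) convex_hull_linear_image[OF linear_dehomogenize, of V]
      by (auto simp: P_def)
    show "p $ i \<in> \<int>" if "p \<in> P" for p i
      using that dehomogenize_expvec_nth[of i] by (auto simp: P_def)
    show "card P = 4"
      using Q(2) inj by (simp add: P_def card_image)
  qed
  then obtain i where i: "(\<Sum>u\<in>Q. dehomogenize (expvec u) $ i) / 2 \<notin> \<int>"
    using inj by (auto simp: P_def sum.reindex)
  obtain j where j: "\<And>u. dehomogenize (expvec u) $ i = real (Poly_Mapping.lookup u j)"
    using dehomogenize_expvec_nth by metis
  have "odd (\<Sum>u\<in>Q. Poly_Mapping.lookup u j)"
  proof
    assume "even (\<Sum>u\<in>Q. Poly_Mapping.lookup u j)"
    then obtain k where "(\<Sum>u\<in>Q. Poly_Mapping.lookup u j) = 2 * k"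
      by (elim evenE)
    then have "(\<Sum>u\<in>Q. real (Poly_Mapping.lookup u j)) / 2 = real k"
      by (simp flip: of_nat_sum)
    then show False
      using i j by simp
  qed
  then show ?thesis ..
qed

section \<open>The Brundu-Logar cubic: exponents, coefficients and linear relations\<close>

definition expo :: "nat \<Rightarrow> nat \<Rightarrow> nat \<Rightarrow> nat \<Rightarrow> exponent" where
  "expo k1 k2 k3 k4 = Poly_Mapping.single 1 k1 + Poly_Mapping.single 2 k2
     + Poly_Mapping.single 3 k3 + Poly_Mapping.single 4 k4"

text \<open>In the index type 4 equals 0, so the last entry gets a rule for both forms.\<close>

lemma lookup_expo [simp]:
  "Poly_Mapping.lookup (expo k1 k2 k3 k4) 1 = k1"
  "Poly_Mapping.lookup (expo k1 k2 k3 k4) 2 = k2"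
  "Poly_Mapping.lookup (expo k1 k2 k3 k4) 3 = k3"
  "Poly_Mapping.lookup (expo k1 k2 k3 k4) 4 = k4"
  "Poly_Mapping.lookup (expo k1 k2 k3 k4) 0 = k4"
  by (simp_all add: expo_def lookup_add lookup_single)

lemma expo_eq_iff [simp]:
  "expo k1 k2 k3 k4 = expo l1 l2 l3 l4 \<longleftrightarrow> k1 = l1 \<and> k2 = l2 \<and> k3 = l3 \<and> k4 = l4"
  by (metis lookup_expo)

lemma Var_eq:
  "Var 1 = Poly_Mapping.single (expo 1 0 0 0) 1"
  "Var 2 = Poly_Mapping.single (expo 0 1 0 0) 1"
  "Var 3 = Poly_Mapping.single (expo 0 0 1 0) 1"
  "Var 4 = Poly_Mapping.single (expo 0 0 0 1) 1"
  by (simp_all add: Var_def expo_def)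

lemma expo_add: "expo k1 k2 k3 k4 + expo l1 l2 l3 l4 = expo (k1 + l1) (k2 + l2) (k3 + l3) (k4 + l4)"
  by (simp add: expo_def single_add algebra_simps)

text \<open>The ten exponents are pairwise distinct, so the coefficients can be read off from this
  form.\<close>

lemma BL_cubic_eq_sum_single:
  "BL_cubic a b c d g =
     Poly_Mapping.single (expo 2 1 0 0) (2 * a)
   + Poly_Mapping.single (expo 2 0 1 0) (b - g)
   + Poly_Mapping.single (expo 1 2 0 0) (- 2 * a)
   + Poly_Mapping.single (expo 1 1 1 0) (d + g)
   + Poly_Mapping.single (expo 1 0 2 0) (a - c - d)
   + Poly_Mapping.single (expo 1 1 0 1) (b + g)
   + Poly_Mapping.single (expo 1 0 1 1) (- a - b - c)
   + Poly_Mapping.single (expo 0 2 0 1) (d - g)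
   + Poly_Mapping.single (expo 0 1 1 1) (a + c - d)
   + Poly_Mapping.single (expo 0 1 0 2) (- a - b + c)"
  by (simp add: BL_cubic_def Const_def Var_eq power2_eq_square mult_single expo_add
    numeral_2_eq_2 del: mult_minus_left)

text \<open>\<open>A, \<dots>, J\<close> stand for the coefficients of the cubic in the order of \<open>BL_cubic\<close>, and \<open>Z\<close> for
  the set of elements of larger than minimal valuation.  The quadruples are among those whose
  exponents have an even sum.\<close>

lemma subgroup_contains_all_if_meets_quadruples:
  fixes Z :: "'k::ab_group_add set"
  assumes add: "\<And>x y. x \<in> Z \<Longrightarrow> y \<in> Z \<Longrightarrow> x + y \<in> Z"
    and minus: "\<And>x. x \<in> Z \<Longrightarrow> - x \<in> Z"
    and rel: "C = - A" "F = B + D - H" "H = A + B - E + G" "I = - B - D - G" "J = - B - D - E"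
    and quads:
      "A \<in> Z \<or> B \<in> Z \<or> C \<in> Z \<or> D \<in> Z"
      "B \<in> Z \<or> E \<in> Z \<or> F \<in> Z \<or> I \<in> Z"
      "D \<in> Z \<or> G \<in> Z \<or> H \<in> Z \<or> J \<in> Z"
      "A \<in> Z \<or> C \<in> Z \<or> E \<in> Z \<or> J \<in> Z"
      "A \<in> Z \<or> C \<in> Z \<or> F \<in> Z \<or> H \<in> Z"
      "A \<in> Z \<or> C \<in> Z \<or> G \<in> Z \<or> I \<in> Z"
      "B \<in> Z \<or> D \<in> Z \<or> E \<in> Z \<or> J \<in> Z"
      "B \<in> Z \<or> E \<in> Z \<or> G \<in> Z \<or> H \<in> Z"
      "D \<in> Z \<or> F \<in> Z \<or> I \<in> Z \<or> J \<in> Z"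
      "F \<in> Z \<or> G \<in> Z \<or> H \<in> Z \<or> I \<in> Z"
      "A \<in> Z \<or> B \<in> Z \<or> F \<in> Z \<or> G \<in> Z"
      "A \<in> Z \<or> B \<in> Z \<or> H \<in> Z \<or> I \<in> Z"
      "A \<in> Z \<or> D \<in> Z \<or> F \<in> Z \<or> I \<in> Z"
      "A \<in> Z \<or> D \<in> Z \<or> G \<in> Z \<or> H \<in> Z"
      "B \<in> Z \<or> C \<in> Z \<or> F \<in> Z \<or> I \<in> Z"
      "B \<in> Z \<or> C \<in> Z \<or> G \<in> Z \<or> H \<in> Z"
      "B \<in> Z \<or> D \<in> Z \<or> F \<in> Z \<or> H \<in> Z"
      "B \<in> Z \<or> D \<in> Z \<or> G \<in> Z \<or> I \<in> Z"
      "B \<in> Z \<or> F \<in> Z \<or> G \<in> Z \<or> J \<in> Z"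
      "B \<in> Z \<or> H \<in> Z \<or> I \<in> Z \<or> J \<in> Z"
      "C \<in> Z \<or> D \<in> Z \<or> F \<in> Z \<or> G \<in> Z"
      "C \<in> Z \<or> D \<in> Z \<or> H \<in> Z \<or> I \<in> Z"
      "D \<in> Z \<or> E \<in> Z \<or> F \<in> Z \<or> G \<in> Z"
      "D \<in> Z \<or> E \<in> Z \<or> H \<in> Z \<or> I \<in> Z"
      "E \<in> Z \<or> F \<in> Z \<or> H \<in> Z \<or> J \<in> Z"
      "E \<in> Z \<or> G \<in> Z \<or> I \<in> Z \<or> J \<in> Z"
  shows "A \<in> Z \<and> B \<in> Z \<and> C \<in> Z \<and> D \<in> Z \<and> E \<in> Z \<and> F \<in> Z \<and> G \<in> Z \<and> H \<in> Z \<and> I \<in> Z \<and> J \<in> Z"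
proof -
  have diff: "x - y \<in> Z" if "x \<in> Z" "y \<in> Z" for x y
    using add[OF that(1) minus[OF that(2)]] by simp
  have eqs:
    "C = - A" "A = - C" "J = - B - D - E" "H = B + D - F" "E = - B - D - J" "D = F + H - B"
    "D = - B - G - I" "B = - D - E - J" "B = - D - G - I" "J = - E - F - H" "I = E + J - G"
    "G = E + J - I" "H = - F - G - I" "E = - F - H - J" "F = - G - H - I" "G = E + H - A - B"
    "G = - A - B - F - J" "E = A + B + G - H" "G = D + E - A - F" "F = D + E - A - G"
    "E = A + F + G - D" "E = A - D - H - I" "D = A + F + G - E" "A = E + H - B - G"
    by (simp_all add: rel algebra_simps)
  \<comment> \<open>In each relation, if all terms but one lie in the subgroup \<open>Z\<close>, so
    does the remaining one.\<close>
  have imps: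
    "A \<in> Z \<longrightarrow> C \<in> Z" "C \<in> Z \<longrightarrow> A \<in> Z"
    "B \<in> Z \<longrightarrow> D \<in> Z \<longrightarrow> E \<in> Z \<longrightarrow> J \<in> Z"
    "B \<in> Z \<longrightarrow> D \<in> Z \<longrightarrow> F \<in> Z \<longrightarrow> H \<in> Z"
    "B \<in> Z \<longrightarrow> D \<in> Z \<longrightarrow> J \<in> Z \<longrightarrow> E \<in> Z"
    "B \<in> Z \<longrightarrow> F \<in> Z \<longrightarrow> H \<in> Z \<longrightarrow> D \<in> Z"
    "B \<in> Z \<longrightarrow> G \<in> Z \<longrightarrow> I \<in> Z \<longrightarrow> D \<in> Z"
    "D \<in> Z \<longrightarrow> E \<in> Z \<longrightarrow> J \<in> Z \<longrightarrow> B \<in> Z"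
    "D \<in> Z \<longrightarrow> G \<in> Z \<longrightarrow> I \<in> Z \<longrightarrow> B \<in> Z"
    "E \<in> Z \<longrightarrow> F \<in> Z \<longrightarrow> H \<in> Z \<longrightarrow> J \<in> Z"
    "E \<in> Z \<longrightarrow> G \<in> Z \<longrightarrow> J \<in> Z \<longrightarrow> I \<in> Z"
    "E \<in> Z \<longrightarrow> I \<in> Z \<longrightarrow> J \<in> Z \<longrightarrow> G \<in> Z"
    "F \<in> Z \<longrightarrow> G \<in> Z \<longrightarrow> I \<in> Z \<longrightarrow> H \<in> Z"
    "F \<in> Z \<longrightarrow> H \<in> Z \<longrightarrow> J \<in> Z \<longrightarrow> E \<in> Z"
    "G \<in> Z \<longrightarrow> H \<in> Z \<longrightarrow> I \<in> Z \<longrightarrow> F \<in> Z"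
    "A \<in> Z \<longrightarrow> B \<in> Z \<longrightarrow> E \<in> Z \<longrightarrow> H \<in> Z \<longrightarrow> G \<in> Z"
    "A \<in> Z \<longrightarrow> B \<in> Z \<longrightarrow> F \<in> Z \<longrightarrow> J \<in> Z \<longrightarrow> G \<in> Z"
    "A \<in> Z \<longrightarrow> B \<in> Z \<longrightarrow> G \<in> Z \<longrightarrow> H \<in> Z \<longrightarrow> E \<in> Z"
    "A \<in> Z \<longrightarrow> D \<in> Z \<longrightarrow> E \<in> Z \<longrightarrow> F \<in> Z \<longrightarrow> G \<in> Z"
    "A \<in> Z \<longrightarrow> D \<in> Z \<longrightarrow> E \<in> Z \<longrightarrow> G \<in> Z \<longrightarrow> F \<in> Z"
    "A \<in> Z \<longrightarrow> D \<in> Z \<longrightarrow> F \<in> Z \<longrightarrow> G \<in> Z \<longrightarrow> E \<in> Z"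
    "A \<in> Z \<longrightarrow> D \<in> Z \<longrightarrow> H \<in> Z \<longrightarrow> I \<in> Z \<longrightarrow> E \<in> Z"
    "A \<in> Z \<longrightarrow> E \<in> Z \<longrightarrow> F \<in> Z \<longrightarrow> G \<in> Z \<longrightarrow> D \<in> Z"
    "B \<in> Z \<longrightarrow> E \<in> Z \<longrightarrow> G \<in> Z \<longrightarrow> H \<in> Z \<longrightarrow> A \<in> Z"
    by (intro impI, subst eqs, (intro add diff minus; assumption))+
  show ?thesis
    \<comment> \<open>What is left is propositional reasoning about ten membership
      statements.\<close>
    using quads imps by argo
qed

section \<open>Elements of large valuation and the final contradiction\<close>

text \<open>The squares of 1 and of -1 are both 1, so additivity on products and finiteness of the
  two valuations make both of them 0.\<close>

lemma valuation_uminus: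
  assumes "is_valuation val"
  shows "val (- x) = val x"
proof -
  have mult: "val (x * y) = val x + val y" for x y
    using assms by (simp add: is_valuation_def)
  have fin: "\<bar>val x\<bar> \<noteq> \<infinity>" if "x \<noteq> 0" for x
    using assms that by (auto simp: is_valuation_def)
  obtain r where r: "val (- 1) = ereal r"
    using fin[of "- 1"] by auto
  obtain q where q: "val 1 = ereal q"
    using fin[of 1] by auto
  have "q = 0" "r = 0"
    using mult[of 1 1] mult[of "- 1" "- 1"] q r by simp_all
  then show ?thesis
    using mult[of "- 1" x] r by (simp add: zero_ereal_def[symmetric])
qed

lemma less_valuation_add:
  assumes "is_valuation val" "m < val x" "m < val y"
  shows "m < val (x + y)"
proof -
  have "m < min (val x) (val y)"
    using assms by simp
  also have "\<dots> \<le> val (x + y)"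
    using assms(1) by (simp add: is_valuation_def)
  finally show ?thesis .
qed

theorem theorem3p4:
  fixes val :: "'k::{alg_closed_field, field_char_0} \<Rightarrow> ereal"
    and f :: "'k poly4"
  assumes "is_valuation val"
    and "val 2 = 0"
    and "BL_normal_form f"
  shows "\<not> tropically_smooth val f"
proof
  assume smooth: "tropically_smooth val f"
  obtain a b c d g where f: "f = BL_cubic a b c d g" and sigma: "BL_sigma a b c d g \<noteq> 0"
    using assms(3) by (auto simp: BL_normal_form_def)
  let ?c = "Poly_Mapping.lookup f"
  have coeffs:
    "?c (expo 2 1 0 0) = 2 * a"
    "?c (expo 2 0 1 0) = b - g"
    "?c (expo 1 2 0 0) = - 2 * a"
    "?c (expo 1 1 1 0) = d + g"
    "?c (expo 1 0 2 0) = a - c - d"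
    "?c (expo 1 1 0 1) = b + g"
    "?c (expo 1 0 1 1) = - a - b - c"
    "?c (expo 0 2 0 1) = d - g"
    "?c (expo 0 1 1 1) = a + c - d"
    "?c (expo 0 1 0 2) = - a - b + c"
    unfolding f BL_cubic_eq_sum_single by (simp_all add: lookup_add lookup_single)
  \<comment> \<open>Only an inclusion, because some coefficients may vanish.\<close>
  have keys: "Poly_Mapping.keys f \<subseteq>
      {expo 2 1 0 0, expo 2 0 1 0, expo 1 2 0 0, expo 1 1 1 0, expo 1 0 2 0,
       expo 1 1 0 1, expo 1 0 1 1, expo 0 2 0 1, expo 0 1 1 1, expo 0 1 0 2}"
    unfolding f BL_cubic_eq_sum_single
    by (auto simp: lookup_add lookup_single when_def in_keys_iff split: if_splits)
  have "Poly_Mapping.keys f \<noteq> {}"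
  proof
    assume "Poly_Mapping.keys f = {}"
    then have "?c u = 0" for u
      by simp
    \<comment> \<open>This difference of two coefficients is \<open>2 * c\<close>, and
      \<open>c\<close> is a factor of \<open>BL_sigma\<close>.\<close>
    then have "a + c - d - (a - c - d) = 0"
      unfolding coeffs[symmetric] by simp
    then have "c = 0"
      by (simp add: algebra_simps flip: mult_2)
    then show False
      using sigma by (simp add: BL_sigma_def)
  qed
  then obtain u0 where u0: "u0 \<in> Poly_Mapping.keys f"
      and min: "\<And>v. v \<in> Poly_Mapping.keys f \<Longrightarrow> val (?c u0) \<le> val (?c v)"
    using ex_min_if_finite[of "(\<lambda>u. val (?c u)) ` Poly_Mapping.keys f"] by (auto simp: not_less)
  define Z where "Z = {x. val (?c u0) < val x}"
  \<comment> \<open>The minimal valuation is finite, so 0 belongs to \<open>Z\<close>. A coefficient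
    outside \<open>Z\<close> is therefore nonzero, and its exponent does occur in
    \<open>f\<close>.\<close>
  have initial: "u \<in> Poly_Mapping.keys f \<and> (\<forall>v\<in>Poly_Mapping.keys f. val (?c u) \<le> val (?c v))"
    if "?c u \<notin> Z" for u
  proof -
    have le: "val (?c u) \<le> val (?c u0)"
      using that by (simp add: Z_def not_less)
    have "val (?c u0) \<noteq> \<infinity>"
      using assms(1) u0 by (simp add: is_valuation_def in_keys_iff)
    then have "?c u \<noteq> 0"
      using assms(1) le by (metis is_valuation_def ereal_infty_less_eq(1))
    then show ?thesis
      using order_trans[OF le min] by (auto simp: in_keys_iff)
  qed
  \<comment> \<open>Four exponents with coefficients outside \<open>Z\<close> have minimal weight,
    so by smoothness their sum has an odd coordinate.\<close>
  have quad: "?c p \<in> Z \<or> ?c q \<in> Z \<or> ?c r \<in> Z \<or> ?c s \<in> Z"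
    if dist: "distinct [p, q, r, s]"
      and degree: "\<forall>u\<in>{p, q, r, s}. (\<Sum>i\<in>UNIV. Poly_Mapping.lookup u i) = 3"
      and even: "\<forall>i. even (Poly_Mapping.lookup p i + Poly_Mapping.lookup q i
        + Poly_Mapping.lookup r i + Poly_Mapping.lookup s i)"
    for p q r s
  proof (rule ccontr)
    assume "\<not> ?thesis"
    then have Q: "\<And>u. u \<in> {p, q, r, s} \<Longrightarrow> ?c u \<notin> Z"
      by auto
    have "\<exists>i. odd (\<Sum>u\<in>{p, q, r, s}. Poly_Mapping.lookup u i)"
      using initial[OF Q] dist degree by (intro odd_sum_if_tropically_smooth[OF smooth]) auto
    then show False
      using dist even by (auto simp: add.assoc)
  qed
  have "?c (expo 2 1 0 0) \<in> Z \<and> ?c (expo 2 0 1 0) \<in> Z \<and> ?c (expo 1 2 0 0) \<in> Z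
      \<and> ?c (expo 1 1 1 0) \<in> Z \<and> ?c (expo 1 0 2 0) \<in> Z \<and> ?c (expo 1 1 0 1) \<in> Z
      \<and> ?c (expo 1 0 1 1) \<in> Z \<and> ?c (expo 0 2 0 1) \<in> Z \<and> ?c (expo 0 1 1 1) \<in> Z
      \<and> ?c (expo 0 1 0 2) \<in> Z"
  proof (rule subgroup_contains_all_if_meets_quadruples)
    show "x + y \<in> Z" if "x \<in> Z" "y \<in> Z" for x y
      using that less_valuation_add[OF assms(1)] by (simp add: Z_def)
    show "- x \<in> Z" if "x \<in> Z" for x
      using that valuation_uminus[OF assms(1)] by (simp add: Z_def)
  \<comment> \<open>The linear relations are identities in \<open>a\<close>, \<open>b\<close>,
    \<open>c\<close>, \<open>d\<close>, \<open>g\<close>; the quadruples need only numerical checks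
    of distinctness, degree and parity.\<close>
  qed ((simp only: coeffs, (simp add: algebra_simps; fail))+,
      (rule quad; simp add: sum_4 forall_4)+)
  then have "?c u0 \<in> Z"
    using u0 keys by blast
  \<comment> \<open>The coefficient at \<open>u0\<close> would have valuation larger than its
    own.\<close>
  then show False
    by (simp add: Z_def)
qed

end
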